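(* Let $V$ be a normed vector space over $\mathbb C$, $A:V\to V$ a linear operator, $\sigma(A)\ne\emptyset$ a fixed set of pairwise different eigenvalues of $A$ with corresponding fixed eigenfunctions $v_\lambda$, $\lambda\in\sigma(A)$. Assume that $\{F_k\}_{k=0}^{M-1}$ forms an admissible set of sampling functionals for $A$. Let $f=\sum_{j=1}^M c_j\,v_{\lambda_j}$ with $c_j\in\mathbb C\setminus\{0\}$ and pairwise distinct $\lambda_1,\dots,\lambda_M\in\sigma(A)$. Then the sampling matrix $$\left(F_k(A^\ell f)\right)_{k=0,\ell=0}^{M-1,M}\in\mathbb C^{M\times(M+1)}$$ possesses rank $M$. Further, if $\varphi:\sigma(A)\to\mathbb C$ is an analytic, injective function and $\Phi=\varphi(A)$ is the corresponding iteration operator of $A$, then also $$\left(F_k(\Phi^\ell f)\right)_{k=0,\ell=0}^{M-1,M}\in\mathbb C^{M\times(M+1)}$$ possesses rank $M$.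
   Context: For each $\lambda\in\sigma(A)$ one fixed eigenfunction $v_\lambda\in V$ is chosen, with $Av_\lambda=\lambda v_\lambda$, $\|v_\lambda\|_V=1$, such that $\lambda\mapsto v_\lambda$ is injective on $\sigma(A)$. Admissible set of sampling functionals: linear functionals $F_k:V\to\mathbb C$, $k=0,\dots,M-1$, form an admissible set of sampling functionals for $A$ if for all finite subsets $\Lambda_M\subset\sigma(A)$ of cardinality $M<\infty$ the matrix $\left(F_k(v_\lambda)\right)_{k=0,\lambda\in\Lambda_M}^{M-1}$ has full rank $M$. Let $\mathcal M(A)$ be the linear span of $\{v_\lambda:\lambda\in\sigma(A)\}$. Analytic on $\sigma(A)$ means that $\varphi(z)=\sum_{n=0}^\infty a_nz^n$ for a power series converging at every $z\in\sigma(A)$; $\varphi(A)$ is the linear operator on $\mathcal M(A)$ given by $\varphi(A)g=\sum_{n=0}^\infty a_nA^ng$, which satisfies $\varphi(A)v_\lambda=\varphi(\lambda)v_\lambda$ for all $\lambda\in\sigma(A)$. The matrices of rank $M$ in the claim are called admissible sampling matrices for $f$. *)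

theory Defs
  imports Complex_Main "HOL-Library.FuncSet" "Jordan_Normal_Form.DL_Rank"
begin

text \<open>Normed vector spaces over the complex numbers. The norm, the metric and the topology are those
  of the underlying real normed space.\<close>

class scaleC =
  fixes scaleC :: "complex \<Rightarrow> 'a \<Rightarrow> 'a" (infixr "*\<^sub>C" 75)

class complex_normed_vector = real_normed_vector + scaleC +
  assumes scaleC_add_right: "a *\<^sub>C (x + y) = a *\<^sub>C x + a *\<^sub>C y"
    and scaleC_add_left: "(a + b) *\<^sub>C x = a *\<^sub>C x + b *\<^sub>C x"
    and scaleC_scaleC: "a *\<^sub>C b *\<^sub>C x = (a * b) *\<^sub>C x"
    and scaleC_one: "1 *\<^sub>C x = x"
    and scaleR_scaleC: "r *\<^sub>R x = complex_of_real r *\<^sub>C x"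
    and norm_scaleC: "norm (a *\<^sub>C x) = cmod a * norm x"

global_interpretation complex_vector:
  vector_space "scaleC :: complex \<Rightarrow> 'a \<Rightarrow> 'a::complex_normed_vector"
  by unfold_locales (simp_all add: scaleC_add_right scaleC_add_left scaleC_scaleC scaleC_one)

instantiation complex :: complex_normed_vector
begin

definition scaleC_complex :: "complex \<Rightarrow> complex \<Rightarrow> complex"
  where "scaleC_complex a x = a * x"

instance
  by standard (simp_all add: scaleC_complex_def algebra_simps norm_mult scaleR_conv_of_real)

end

text \<open>The set \<open>S\<close> plays the role of the fixed set of eigenvalues. That its members are eigenvalues
  is part of the definition, since \<open>v \<mu>\<close> is an eigenvector (nonzero because of its norm).\<close>

definition eigenfunction_choice ::
    "('v::complex_normed_vector \<Rightarrow> 'v) \<Rightarrow> complex set \<Rightarrow> (complex \<Rightarrow> 'v) \<Rightarrow> bool"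
  where "eigenfunction_choice A S v \<longleftrightarrow>
    (\<forall>\<mu>\<in>S. A (v \<mu>) = \<mu> *\<^sub>C v \<mu> \<and> norm (v \<mu>) = 1) \<and> inj_on v S"

text \<open>The columns of the matrix are indexed by the finite set \<open>\<Lambda>\<close>; its elements are put in an order
  by an arbitrary enumeration \<open>e\<close>, on which the rank does not depend.\<close>

definition admissible_sampling ::
    "complex set \<Rightarrow> (complex \<Rightarrow> 'v::complex_normed_vector) \<Rightarrow> nat \<Rightarrow> (nat \<Rightarrow> 'v \<Rightarrow> complex) \<Rightarrow> bool"
  where "admissible_sampling S v M F \<longleftrightarrow>
    (\<forall>k<M. Vector_Spaces.linear scaleC (*) (F k)) \<and>
    (\<forall>\<Lambda> e. \<Lambda> \<subseteq> S \<longrightarrow> finite \<Lambda> \<longrightarrow> card \<Lambda> = M \<longrightarrow> bij_betw e {..<M} \<Lambda> \<longrightarrow>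
       vec_space.rank M (mat M M (\<lambda>(k, j). F k (v (e j)))) = M)"

definition sampling_matrix ::
    "nat \<Rightarrow> (nat \<Rightarrow> 'v \<Rightarrow> complex) \<Rightarrow> ('v \<Rightarrow> 'v) \<Rightarrow> 'v \<Rightarrow> complex mat"
  where "sampling_matrix M F T f = mat M (M + 1) (\<lambda>(k, l). F k ((T ^^ l) f))"

text \<open>\<open>\<phi>\<close> is analytic on \<open>S\<close> if it has such a power series expansion with some coefficients \<open>a\<close>.\<close>

definition has_power_series_on ::
    "(complex \<Rightarrow> complex) \<Rightarrow> (nat \<Rightarrow> complex) \<Rightarrow> complex set \<Rightarrow> bool"
  where "has_power_series_on \<phi> a S \<longleftrightarrow> (\<forall>z\<in>S. (\<lambda>n. a n * z ^ n) sums \<phi> z)"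

definition eigenfunction_span ::
    "complex set \<Rightarrow> (complex \<Rightarrow> 'v::complex_normed_vector) \<Rightarrow> 'v set"
  where "eigenfunction_span S v = complex_vector.span (v ` S)"

text \<open>The operator \<open>\<phi>(A)\<close> for \<open>\<phi>\<close> with coefficients \<open>a\<close>: it is defined on the span of the
  eigenfunctions only, where the series converges in norm, and left unspecified elsewhere.\<close>

definition iteration_operator ::
    "('v::complex_normed_vector \<Rightarrow> 'v) \<Rightarrow> complex set \<Rightarrow> (complex \<Rightarrow> 'v) \<Rightarrow> (nat \<Rightarrow> complex) \<Rightarrow> 'v \<Rightarrow> 'v"
  where "iteration_operator A S v a = (\<lambda>g\<in>eigenfunction_span S v. \<Sum>n. a n *\<^sub>C (A ^^ n) g)"

lemma iteration_operator_eigenfunction: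
  assumes A: "Vector_Spaces.linear scaleC scaleC A"
    and v: "eigenfunction_choice A S v"
    and \<phi>: "has_power_series_on \<phi> a S"
    and \<mu>: "\<mu> \<in> S"
  shows "iteration_operator A S v a (v \<mu>) = \<phi> \<mu> *\<^sub>C v \<mu>"
proof -
  interpret A: Vector_Spaces.linear scaleC scaleC A by (rule A)
  have ev: "A (v \<mu>) = \<mu> *\<^sub>C v \<mu>"
    using v \<mu> by (auto simp: eigenfunction_choice_def)
  have pow: "(A ^^ n) (v \<mu>) = \<mu> ^ n *\<^sub>C v \<mu>" for n
    by (induction n) (simp_all add: A.scale ev scaleC_scaleC mult.commute)
  have bl: "bounded_linear (\<lambda>c. c *\<^sub>C v \<mu>)"
    by (rule bounded_linear_intro[where K = "norm (v \<mu>)"])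
      (simp_all add: scaleC_add_left scaleR_scaleC scaleC_scaleC norm_scaleC scaleR_conv_of_real scaleC_complex_def)
  have "(\<lambda>n. (a n * \<mu> ^ n) *\<^sub>C v \<mu>) sums (\<phi> \<mu> *\<^sub>C v \<mu>)"
    using bounded_linear.sums[OF bl] \<phi> \<mu> by (auto simp: has_power_series_on_def)
  hence "(\<Sum>n. a n *\<^sub>C (A ^^ n) (v \<mu>)) = \<phi> \<mu> *\<^sub>C v \<mu>"
    by (simp add: pow scaleC_scaleC sums_iff)
  moreover have "v \<mu> \<in> eigenfunction_span S v"
    using \<mu> by (auto simp: eigenfunction_span_def intro: complex_vector.span_base)
  ultimately show ?thesis by (simp add: iteration_operator_def)
qed

end

theory Submission
  imports Defs
begin

text \<open>
  Put \<open>x\<^sub>j = \<lambda>\<^sub>j\<close> in the case of \<open>A\<close> and \<open>x\<^sub>j = \<phi>(\<lambda>\<^sub>j)\<close> in the case of \<open>\<phi>(A)\<close>. Either operator multiplies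
  the \<open>j\<close>-th eigenfunction by \<open>x\<^sub>j\<close>, so its \<open>l\<close>-th iterate takes \<open>f\<close> to \<open>\<Sum>\<^sub>j c\<^sub>j x\<^sub>j\<^sup>l v\<^sub>j\<close>, and the first \<open>M\<close>
  columns of the sampling matrix form the product of three square matrices: the matrix \<open>F\<^sub>k(v\<^sub>j)\<close>,
  the diagonal matrix of the \<open>c\<^sub>j\<close>, and the Vandermonde matrix of the \<open>x\<^sub>j\<close>. The first is regular by
  admissibility, the second because no \<open>c\<^sub>j\<close> vanishes, and the third because the nodes \<open>x\<^sub>j\<close> are
  distinct (for \<open>\<phi>(A)\<close> this is the injectivity of \<open>\<phi>\<close>). A matrix with \<open>M\<close> rows that contains the
  columns of a regular square block has rank \<open>M\<close>.

  The two cases differ only in why the operator acts diagonally on combinations of the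
  eigenfunctions: for \<open>\<phi>(A)\<close> this interchanges the power series with a finite sum
  (lemma \<open>iteration_operator_sum_eigenfunctions\<close>). What is common to them is
  lemma \<open>sampling_matrix_full_rank\<close>.
\<close>

lemma (in vec_space) rank_le_nr:
  assumes "A \<in> carrier_mat n nc"
  shows "rank A \<le> n"
proof -
  obtain U where U: "maximal U (\<lambda>T. T \<subseteq> set (cols A) \<and> lin_indpt T)"
    using maximal_exists_superset[of "set (cols A)" "\<lambda>T. T \<subseteq> set (cols A) \<and> lin_indpt T" "{}"]
      finite_lin_indpt2[of "{}"] by auto
  hence "U \<subseteq> set (cols A)" "lin_indpt U"
    by (auto simp: maximal_def)
  moreover have "set (cols A) \<subseteq> carrier_vec n"
    using assms cols_dim by blast
  ultimately have "card U \<le> n"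
    using li_le_dim(2)[OF fin_dim, of U] dim_is_n by auto
  thus ?thesis
    using rank_card_indpt[OF assms U] by simp
qed

lemma (in vec_space) rank_eq_nr_if_regular_columns:
  assumes A: "A \<in> carrier_mat n nc" and B: "B \<in> carrier_mat n n"
    and det: "det B \<noteq> 0" and sub: "set (cols B) \<subseteq> set (cols A)"
  shows "rank A = n"
proof -
  have rank_B: "rank B = n"
    using det_rank_iff[OF B] det by simp
  hence dist: "distinct (cols B)"
    using non_distinct_low_rank[OF B] by (metis less_irrefl)
  have "n = card (set (cols B))"
    using distinct_card[OF dist] B by simp
  also have "\<dots> \<le> rank A"
    by (rule rank_ge_card_indpt[OF A sub full_rank_lin_indpt[OF B rank_B dist]])
  finally show ?thesis
    using rank_le_nr[OF A] by simp
qed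

text \<open>A vector in the kernel is the coefficient vector of a polynomial of degree less than \<open>n\<close> that
  vanishes at \<open>n\<close> distinct nodes.\<close>

lemma det_vandermonde_nonzero:
  fixes x :: "nat \<Rightarrow> 'a::idom"
  assumes inj: "inj_on x {..<n}"
  shows "det (mat n n (\<lambda>(j, l). x j ^ l)) \<noteq> 0"
proof
  let ?W = "mat n n (\<lambda>(j, l). x j ^ l)"
  assume "det ?W = 0"
  then obtain u where u: "u \<in> carrier_vec n" "u \<noteq> 0\<^sub>v n" "?W *\<^sub>v u = 0\<^sub>v n"
    using det_0_iff_vec_prod_zero[of ?W n] by auto
  hence n: "0 < n" by (cases n) auto
  define p where "p = (\<Sum>l<n. monom (u $ l) l)"
  have deg: "degree p < n"
    unfolding p_def by (rule degree_sum_less) (auto intro: le_less_trans[OF degree_monom_le] n)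
  have root: "poly p (x j) = 0" if j: "j < n" for j
  proof -
    have "poly p (x j) = (\<Sum>l<n. x j ^ l * u $ l)"
      by (simp add: p_def poly_sum poly_monom mult.commute)
    also have "\<dots> = (?W *\<^sub>v u) $ j"
      using j u(1) by (simp add: scalar_prod_def lessThan_atLeast0)
    finally show ?thesis using u(3) j by simp
  qed
  have "p = 0"
    by (rule poly_eqI_degree[of "x ` {..<n}"]) (use root deg n inj in \<open>auto simp: card_image\<close>)
  hence "u $ l = 0" if "l < n" for l
  proof -
    have "coeff p l = u $ l"
      using that by (simp add: p_def coeff_sum)
    thus ?thesis using \<open>p = 0\<close> by simp
  qed
  hence "u = 0\<^sub>v n"
    using u(1) by auto
  thus False using u(2) by simp
qed

lemma funpow_sum_eigenvectors:
  fixes T :: "'v::complex_normed_vector \<Rightarrow> 'v"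
  assumes "\<And>b. T (\<Sum>j\<in>J. b j *\<^sub>C w j) = (\<Sum>j\<in>J. (b j * x j) *\<^sub>C w j)"
  shows "(T ^^ l) (\<Sum>j\<in>J. b j *\<^sub>C w j) = (\<Sum>j\<in>J. (b j * x j ^ l) *\<^sub>C w j)"
  by (induction l) (simp_all add: assms mult_ac)

text \<open>The operator \<open>T\<close> only has to act diagonally on the combinations of the \<open>w j\<close>, which form an
  invariant set containing \<open>f\<close>. Linearity of \<open>T\<close> on the whole space would exclude \<open>\<phi>(A)\<close>, whose
  domain is the span of the eigenfunctions.\<close>

lemma sampling_matrix_full_rank:
  fixes T :: "'v::complex_normed_vector \<Rightarrow> 'v"
  assumes lin: "\<forall>k<M. Vector_Spaces.linear scaleC (*) (F k)"
    and rank: "vec_space.rank M (mat M M (\<lambda>(k, j). F k (w j))) = M"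
    and T: "\<And>b. T (\<Sum>j<M. b j *\<^sub>C w j) = (\<Sum>j<M. (b j * x j) *\<^sub>C w j)"
    and c: "\<forall>j<M. c j \<noteq> 0" and inj: "inj_on x {..<M}"
    and f: "f = (\<Sum>j<M. c j *\<^sub>C w j)"
  shows "vec_space.rank M (sampling_matrix M F T f) = M"
proof -
  let ?G = "mat M M (\<lambda>(k, j). F k (w j))"
  let ?D = "mat_diag M c"
  let ?W = "mat M M (\<lambda>(j, l). x j ^ l)"
  let ?A = "sampling_matrix M F T f"
  let ?B = "?G * (?D * ?W)"
  have "det ?G \<noteq> 0"
    using vec_space.det_rank_iff[of ?G M] rank by simp
  moreover have "det ?D = (\<Prod>j<M. c j)"
    by (subst det_upper_triangular[of _ M])
      (auto simp: mat_diag_def prod_list_diag_prod lessThan_atLeast0)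
  moreover have "det ?B = det ?G * (det ?D * det ?W)"
    by (simp only: det_mult[OF mat_diag_dim mat_carrier]
        det_mult[OF mat_carrier mult_carrier_mat[OF mat_diag_dim mat_carrier]])
  ultimately have det: "det ?B \<noteq> 0"
    using c det_vandermonde_nonzero[OF inj] by simp
  have F: "F k ((T ^^ l) f) = (\<Sum>j<M. c j * x j ^ l * F k (w j))" if "k < M" for k l
  proof -
    interpret Fk: Vector_Spaces.linear scaleC "(*)" "F k"
      using lin that by simp
    have "(T ^^ l) f = (\<Sum>j<M. (c j * x j ^ l) *\<^sub>C w j)"
      unfolding f by (rule funpow_sum_eigenvectors) (rule T)
    thus ?thesis
      by (simp add: Fk.sum Fk.scale)
  qed
  have DW: "?D * ?W = mat M M (\<lambda>(j, l). c j * x j ^ l)"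
    by (subst mat_diag_mult_left[of _ M M]) (auto intro!: cong_mat)
  have B: "?B = mat M M (\<lambda>(k, l). F k ((T ^^ l) f))"
    unfolding DW by (rule eq_matI) (auto simp: scalar_prod_def F lessThan_atLeast0 mult_ac)
  have A: "?A \<in> carrier_mat M (M + 1)"
    by (simp add: sampling_matrix_def)
  have col: "col ?B l = col ?A l" if "l < M" for l
    unfolding B using that by (intro eq_vecI) (auto simp: sampling_matrix_def)
  have "col ?B l \<in> set (cols ?A)" if "l < M" for l
    using col[OF that] that A by (auto simp: cols_def)
  hence "set (cols ?B) \<subseteq> set (cols ?A)"
    by (auto simp: cols_def)
  thus ?thesis
    by (intro vec_space.rank_eq_nr_if_regular_columns[OF A _ det]) auto
qed

text \<open>A finite combination of the eigenfunctions lies in the span, where the operator is given by its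
  series, and the series of a finite sum is the sum of the series. Each summand is the value on one
  eigenfunction, up to a constant factor.\<close>

lemma iteration_operator_sum_eigenfunctions:
  fixes A :: "'v::complex_normed_vector \<Rightarrow> 'v"
  assumes A: "Vector_Spaces.linear scaleC scaleC A"
    and v: "eigenfunction_choice A S v"
    and \<phi>: "has_power_series_on \<phi> a S"
    and mu: "\<And>j. j \<in> J \<Longrightarrow> \<mu> j \<in> S"
  shows "iteration_operator A S v a (\<Sum>j\<in>J. b j *\<^sub>C v (\<mu> j)) = (\<Sum>j\<in>J. (b j * \<phi> (\<mu> j)) *\<^sub>C v (\<mu> j))"
proof -
  let ?g = "\<Sum>j\<in>J. b j *\<^sub>C v (\<mu> j)"
  interpret A: Vector_Spaces.linear scaleC scaleC A by (rule A)
  have "A (\<Sum>j\<in>J. b j *\<^sub>C v (\<mu> j)) = (\<Sum>j\<in>J. (b j * \<mu> j) *\<^sub>C v (\<mu> j))" for b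
    using v mu by (auto simp: A.sum A.scale eigenfunction_choice_def scaleC_scaleC intro!: sum.cong)
  hence pow: "(A ^^ n) ?g = (\<Sum>j\<in>J. (b j * \<mu> j ^ n) *\<^sub>C v (\<mu> j))" for n
    by (rule funpow_sum_eigenvectors)
  have bl: "bounded_linear (\<lambda>z. z *\<^sub>C y)" for y :: 'v
    by (rule bounded_linear_intro[where K = "norm y"])
      (simp_all add: scaleC_add_left scaleR_scaleC scaleC_scaleC norm_scaleC scaleR_conv_of_real
        scaleC_complex_def)
  have "(\<lambda>n. \<Sum>j\<in>J. (b j * (a n * \<mu> j ^ n)) *\<^sub>C v (\<mu> j)) sums (\<Sum>j\<in>J. (b j * \<phi> (\<mu> j)) *\<^sub>C v (\<mu> j))"
    using \<phi> mu by (intro sums_sum bounded_linear.sums[OF bl] sums_mult)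
      (auto simp: has_power_series_on_def)
  hence "(\<Sum>n. a n *\<^sub>C (A ^^ n) ?g) = (\<Sum>j\<in>J. (b j * \<phi> (\<mu> j)) *\<^sub>C v (\<mu> j))"
    by (simp add: pow complex_vector.scale_sum_right scaleC_scaleC sums_iff mult.left_commute)
  moreover have "?g \<in> eigenfunction_span S v"
    unfolding eigenfunction_span_def using mu
    by (intro complex_vector.span_sum complex_vector.span_scale complex_vector.span_base) auto
  ultimately show ?thesis
    by (simp add: iteration_operator_def)
qed

theorem theorem3p7:
  fixes A :: "'v::complex_normed_vector \<Rightarrow> 'v"
    and S :: "complex set"
    and v :: "complex \<Rightarrow> 'v"
    and M :: nat
    and F :: "nat \<Rightarrow> 'v \<Rightarrow> complex"
    and c lam :: "nat \<Rightarrow> complex"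
    and f :: 'v
  assumes "Vector_Spaces.linear scaleC scaleC A"
    and "S \<noteq> {}"
    and "eigenfunction_choice A S v"
    and "admissible_sampling S v M F"
    and "\<forall>j\<in>{1..M}. c j \<noteq> 0"
    and "\<forall>j\<in>{1..M}. lam j \<in> S"
    and "inj_on lam {1..M}"
    and "f = (\<Sum>j=1..M. c j *\<^sub>C v (lam j))"
  shows "vec_space.rank M (sampling_matrix M F A f) = M \<and>
    (\<forall>\<phi> a. has_power_series_on \<phi> a S \<longrightarrow> inj_on \<phi> S \<longrightarrow>
       vec_space.rank M (sampling_matrix M F (iteration_operator A S v a) f) = M)"
proof (intro conjI allI impI)
  \<comment> \<open>Matrix indices start at 0, the eigenvalues are numbered from 1.\<close>
  let ?\<mu> = "\<lambda>j. lam (Suc j)"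
  let ?c = "\<lambda>j. c (Suc j)"
  have mu: "?\<mu> j \<in> S" if "j < M" for j
    using assms(6) that by simp
  have inj: "inj_on ?\<mu> {..<M}"
    by (rule inj_onI) (use inj_onD[OF assms(7)] in force)
  have c: "\<forall>j<M. ?c j \<noteq> 0"
    using assms(5) by simp
  have f: "f = (\<Sum>j<M. ?c j *\<^sub>C v (?\<mu> j))"
    unfolding assms(8) by (simp add: sum.atLeast1_atMost_eq)
  have lin: "\<forall>k<M. Vector_Spaces.linear scaleC (*) (F k)"
    using assms(4) by (simp add: admissible_sampling_def)
  have "?\<mu> ` {..<M} \<subseteq> S" "card (?\<mu> ` {..<M}) = M" "bij_betw ?\<mu> {..<M} (?\<mu> ` {..<M})"
    using mu inj by (auto simp: card_image bij_betw_def)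
  hence rank: "vec_space.rank M (mat M M (\<lambda>(k, j). F k (v (?\<mu> j)))) = M"
    using assms(4) unfolding admissible_sampling_def by blast
  interpret A: Vector_Spaces.linear scaleC scaleC A by (rule assms(1))
  have "A (\<Sum>j<M. b j *\<^sub>C v (?\<mu> j)) = (\<Sum>j<M. (b j * ?\<mu> j) *\<^sub>C v (?\<mu> j))" for b
    using assms(3) mu
    by (auto simp: A.sum A.scale eigenfunction_choice_def scaleC_scaleC intro!: sum.cong)
  thus "vec_space.rank M (sampling_matrix M F A f) = M"
    by (rule sampling_matrix_full_rank[OF lin rank _ c inj f])
  fix \<phi> a
  assume \<phi>: "has_power_series_on \<phi> a S" and "inj_on \<phi> S"
  hence inj_\<phi>: "inj_on (\<lambda>j. \<phi> (?\<mu> j)) {..<M}"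
    using inj mu by (auto simp: inj_on_def)
  show "vec_space.rank M (sampling_matrix M F (iteration_operator A S v a) f) = M"
    by (rule sampling_matrix_full_rank[OF lin rank
          iteration_operator_sum_eigenfunctions[OF assms(1,3) \<phi>] c inj_\<phi> f]) (simp add: mu)
qed

end
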